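(* Let $n\ge1$ and let $m$ be a positive integer. Let $\eta,\lambda$ be vectors of integers in $\mathcal A^{\tilde C_n}_m=\{(x_1,\dots,x_n): m>x_1>x_2>\dots>x_n>0\}$. Then, as $k\to\infty$ with $k\equiv|\eta|+|\lambda|\pmod2$, the number of walks from $\eta$ to $\lambda$ with exactly $k$ standard steps staying in $\mathcal A^{\tilde C_n}_m$ is asymptotically $$\frac{2^{2n^2-n+1}}{m^n}\left(\frac{2\sin\frac{n\pi}{2m}\cos\frac{(n+1)\pi}{2m}}{\sin\frac{\pi}{2m}}\right)^k\prod_{1\le h<t\le n}\left(\sin\frac{\pi(\eta_h-\eta_t)}{2m}\sin\frac{\pi(\lambda_h-\lambda_t)}{2m}\right)\prod_{1\le h\le t\le n}\left(\sin\frac{\pi(\eta_h+\eta_t)}{2m}\sin\frac{\pi(\lambda_h+\lambda_t)}{2m}\right).$$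
   Context: For $\eta\in\mathbb R^n$, $|\eta|=\eta_1+\dots+\eta_n$. A walk with $k$ standard steps from $\eta$ to $\lambda$ is a sequence $p_0=\eta,\dots,p_k=\lambda$ with $p_i-p_{i-1}\in\{\pm e_1,\dots,\pm e_n\}$; it stays in $R$ if all $p_i\in R$. "Asymptotically $E$" means the ratio of the count to $E$ tends to $1$. *)

theory Defs
  imports
    "Jordan_Normal_Form.Matrix"
    "HOL-Library.Landau_Symbols"
    "HOL-Number_Theory.Cong"
begin

unbundle asymp_equiv_syntax

(* The n-dimensional vectors are those of carrier_vec n; coordinates are indexed by 0, ..., n-1,
   so that x $ i stands for the coordinate usually written with index i+1.

   The relation f ~[F] g of Landau_Symbols is convergence of f/g to 1 with the convention that
   the ratio is 1 where both functions vanish. The convention matters for the alcove below only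
   if m = n + 1: then the alcove contains a single integer point, and for all k > 0 the number
   of walks and the asymptotic expression are both 0. *)

definition coord_sum :: "'a::comm_monoid_add vec \<Rightarrow> 'a" where
  "coord_sum x = (\<Sum>i<dim_vec x. x $ i)"

definition standard_steps :: "nat \<Rightarrow> real vec set" where
  "standard_steps n = (\<Union>i<n. {unit_vec n i, - unit_vec n i})"

(* A walk with k steps is represented by the list of its k + 1 points. *)
definition walks ::
  "nat \<Rightarrow> real vec set \<Rightarrow> nat \<Rightarrow> real vec \<Rightarrow> real vec \<Rightarrow> real vec list set" where
  "walks n R k a b = {p. length p = k + 1 \<and> set p \<subseteq> carrier_vec n \<and>
     p ! 0 = a \<and> p ! k = b \<and>
     (\<forall>i\<in>{1..k}. p ! i - p ! (i - 1) \<in> standard_steps n) \<and>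
     set p \<subseteq> R}"

(* Intended for n > 0. *)
definition alcove :: "nat \<Rightarrow> nat \<Rightarrow> real vec set" where
  "alcove n m = {x \<in> carrier_vec n.
     real m > x $ 0 \<and> (\<forall>i. i + 1 < n \<longrightarrow> x $ i > x $ (i + 1)) \<and> x $ (n - 1) > 0}"

end

(* The points of the alcove are configurations of n non-colliding walkers on the path 1, ..., m - 1,
   of which one moves at each step. The one-step operator on antisymmetric functions is therefore
   diagonalised by the Slater determinants of the eigenfunctions sin (pi c x / m) of the path, with
   energy equal to the sum of 2 cos (pi c / m) over the chosen modes c. Summing over ordered choices
   of modes, antisymmetrised only in the end point, makes the walk recursion, the vanishing on the
   walls and the initial condition direct, without a Cauchy-Binet argument.

   The energy of largest modulus is attained by the modes 1, ..., n and, with opposite sign, by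
   their reflections m - n, ..., m - 1; on the prescribed parity class of k both contribute equally.
   The Slater determinant of the modes 1, ..., n is a Vandermonde-type product in cos (pi x / m),
   which gives the products of sines. *)

theory Submission
  imports Defs "Jordan_Normal_Form.Determinant"
begin

subsection \<open>Trigonometric sums\<close>

text \<open>Multiplication by the sine of the half angle makes the sum telescope: each cosine
  becomes a difference of sines at consecutive half-integer multiples of \<alpha>.\<close>

lemma sin_half_times_sum_cos:
  fixes \<alpha> :: real
  shows "2 * sin (\<alpha> / 2) * (\<Sum>c<m. cos (real c * \<alpha>))
    = sin ((real m - 1 / 2) * \<alpha>) + sin (\<alpha> / 2)"
proof (induction m)
  case 0
  have "(real 0 - 1 / 2) * \<alpha> = - (\<alpha> / 2)" by simp
  then show ?case by (simp only: sin_minus) simp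
next
  case (Suc m)
  have "2 * sin (\<alpha> / 2) * cos (real m * \<alpha>)
      = sin ((real (Suc m) - 1 / 2) * \<alpha>) - sin ((real m - 1 / 2) * \<alpha>)"
  proof -
    have "((real (Suc m) - 1 / 2) * \<alpha> - (real m - 1 / 2) * \<alpha>) / 2 = \<alpha> / 2"
      "((real (Suc m) - 1 / 2) * \<alpha> + (real m - 1 / 2) * \<alpha>) / 2 = real m * \<alpha>"
      by (simp_all add: algebra_simps)
    then show ?thesis by (simp only: sin_diff_sin)
  qed
  then show ?case using Suc by (simp add: algebra_simps)
qed

text \<open>Used in \<open>energy_Suc\<close>, where it produces the quotient that is raised to the
  power k in the theorem.\<close>

lemma sum_cos_multiples:
  assumes "0 < sin (\<alpha> / 2)"
  shows "(\<Sum>i<n. cos (real (Suc i) * \<alpha>))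
    = sin (real n * \<alpha> / 2) * cos ((real n + 1) * \<alpha> / 2) / sin (\<alpha> / 2)"
proof -
  have "(\<Sum>c<Suc n. cos (real c * \<alpha>)) = 1 + (\<Sum>i<n. cos (real (Suc i) * \<alpha>))"
    by (subst sum.lessThan_Suc_shift) simp
  then have "2 * sin (\<alpha> / 2) * (\<Sum>i<n. cos (real (Suc i) * \<alpha>))
      = sin ((real n + 1 / 2) * \<alpha>) - sin (\<alpha> / 2)"
    using sin_half_times_sum_cos[of \<alpha> "Suc n"] by (simp add: algebra_simps)
  also have "\<dots> = 2 * sin (real n * \<alpha> / 2) * cos ((real n + 1) * \<alpha> / 2)"
  proof -
    have "((real n + 1 / 2) * \<alpha> - \<alpha> / 2) / 2 = real n * \<alpha> / 2"
      "((real n + 1 / 2) * \<alpha> + \<alpha> / 2) / 2 = (real n + 1) * \<alpha> / 2"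
      by (simp_all add: algebra_simps)
    then show ?thesis by (simp only: sin_diff_sin)
  qed
  finally show ?thesis using assms by (simp add: field_simps)
qed

text \<open>The bound on \<open>d\<close> keeps d/(2m) from being an integer, so the half-angle sine
  can be cancelled. The value depends on the parity of \<open>d\<close> alone, which is what the
  orthogonality of the modes exploits.\<close>

lemma sum_cos_full_period:
  fixes d :: int
  assumes "m > 0" "d \<noteq> 0" "\<bar>d\<bar> < 2 * int m"
  shows "(\<Sum>c<m. cos (pi * real c * real_of_int d / real m)) = (1 - cos (pi * real_of_int d)) / 2"
proof -
  define \<alpha> where "\<alpha> = pi * real_of_int d / real m"
  have "sin (\<alpha> / 2) \<noteq> 0"
  proof
    assume "sin (\<alpha> / 2) = 0"
    then obtain i :: int where "\<alpha> / 2 = real_of_int i * pi"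
      using sin_zero_iff_int2 by blast
    then have "real_of_int d = real_of_int (2 * int m * i)"
      using \<open>m > 0\<close> by (simp add: \<alpha>_def field_simps)
    then have "d = 2 * int m * i" by linarith
    with assms show False
      by (metis dvd_imp_le_int dvd_triv_left linorder_not_le abs_of_nat abs_mult abs_numeral)
  qed
  moreover have "2 * sin (\<alpha> / 2) * (\<Sum>c<m. cos (real c * \<alpha>))
      = (1 - cos (pi * real_of_int d)) * sin (\<alpha> / 2)"
  proof -
    have "(real m - 1 / 2) * \<alpha> = pi * real_of_int d - \<alpha> / 2"
      using \<open>m > 0\<close> by (simp add: \<alpha>_def field_simps)
    moreover have "sin (pi * real_of_int d) = 0" by (simp add: sin_zero_iff_int2)
    ultimately have "sin ((real m - 1 / 2) * \<alpha>) = - cos (pi * real_of_int d) * sin (\<alpha> / 2)"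
      by (simp add: sin_diff)
    then show ?thesis by (simp only: sin_half_times_sum_cos) (simp add: left_diff_distrib)
  qed
  then have "sin (\<alpha> / 2) * (2 * (\<Sum>c<m. cos (real c * \<alpha>)))
      = sin (\<alpha> / 2) * (1 - cos (pi * real_of_int d))"
    by (simp only: ac_simps)
  ultimately have "2 * (\<Sum>c<m. cos (real c * \<alpha>)) = 1 - cos (pi * real_of_int d)"
    by (metis mult_left_cancel)
  then have "(\<Sum>c<m. cos (real c * \<alpha>)) = (1 - cos (pi * real_of_int d)) / 2"
    by simp
  moreover have "pi * real c * real_of_int d / real m = real c * \<alpha>" for c
    by (simp add: \<alpha>_def)
  ultimately show ?thesis by simp
qed

text \<open>For 0 < c < m these are the eigenfunctions of the path with Dirichlet walls at 0 and m.
  The position is an integer so that x - 1 and differences of positions are free of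
  truncation.\<close>

definition mode :: "nat \<Rightarrow> nat \<Rightarrow> int \<Rightarrow> real" where
  "mode m c x = sin (pi * real c * real_of_int x / real m)"

lemma mode_0 [simp]: "mode m c 0 = 0"
  by (simp add: mode_def)

lemma mode_end [simp]: "mode m c (int m) = 0"
  by (cases "m = 0") (simp_all add: mode_def)

lemma cos_pi_int: "cos (pi * real_of_int x) = (if even x then 1 else - 1)"
  by (cases "even x") (auto elim!: evenE oddE simp: ring_distribs cos_add sin_zero_iff_int2 cos_one_2pi_int)

text \<open>This is the completeness relation: the positions are fixed and the modes are summed. The
  product formula leaves cosine sums at x - y and x + y, which have equal parity and hence cancel
  unless x = y.\<close>

lemma mode_orthogonal:
  fixes x y :: int
  assumes "0 < x" "x < int m" "0 < y" "y < int m"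
  shows "2 / real m * (\<Sum>c\<in>{1..<m}. mode m c x * mode m c y) = (if x = y then 1 else 0)"
proof -
  have m: "m > 0" using assms by simp
  have prod: "mode m c x * mode m c y
      = (cos (pi * real c * real_of_int (x - y) / real m)
         - cos (pi * real c * real_of_int (x + y) / real m)) / 2" for c
    unfolding mode_def sin_times_sin
    by (simp add: diff_divide_distrib add_divide_distrib ring_distribs)
  \<comment> \<open>The mode c = 0 is identically zero, so the full range of
    \<open>sum_cos_full_period\<close> can be used.\<close>
  have "(\<Sum>c\<in>{1..<m}. mode m c x * mode m c y) = (\<Sum>c<m. mode m c x * mode m c y)"
    by (rule sum.mono_neutral_left) (auto simp: mode_def not_less_eq_eq)
  also have "\<dots> = ((\<Sum>c<m. cos (pi * real c * real_of_int (x - y) / real m))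
      - (\<Sum>c<m. cos (pi * real c * real_of_int (x + y) / real m))) / 2"
    by (simp only: prod sum_divide_distrib[symmetric] sum_subtractf)
  also have "(\<Sum>c<m. cos (pi * real c * real_of_int (x + y) / real m))
      = (1 - cos (pi * real_of_int (x + y))) / 2"
    using assms by (intro sum_cos_full_period) auto
  also have "cos (pi * real_of_int (x + y)) = cos (pi * real_of_int (x - y))"
    by (simp only: cos_pi_int) simp
  finally have eq: "(\<Sum>c\<in>{1..<m}. mode m c x * mode m c y)
      = ((\<Sum>c<m. cos (pi * real c * real_of_int (x - y) / real m))
        - (1 - cos (pi * real_of_int (x - y))) / 2) / 2" .
  show ?thesis
  proof (cases "x = y")
    case True
    then show ?thesis using eq m by simp
  next
    case False
    have "(\<Sum>c<m. cos (pi * real c * real_of_int (x - y) / real m))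
      = (1 - cos (pi * real_of_int (x - y))) / 2"
      using assms False by (intro sum_cos_full_period) auto
    then have "(\<Sum>c\<in>{1..<m}. mode m c x * mode m c y) = 0"
      unfolding eq by simp
    then show ?thesis using False by (simp only: mult_zero_right if_False)
  qed
qed

text \<open>The eigenvalue equation of the path; the factor is the contribution of one walker to the
  energy.\<close>

lemma mode_neighbours:
  "mode m c (x + 1) + mode m c (x - 1) = 2 * cos (pi * real c / real m) * mode m c x"
proof -
  have "mode m c (x + 1) = sin (pi * real c * real_of_int x / real m + pi * real c / real m)"
    "mode m c (x - 1) = sin (pi * real c * real_of_int x / real m - pi * real c / real m)"
    by (simp_all add: mode_def ring_distribs add_divide_distrib diff_divide_distrib)
  then show ?thesis by (simp add: mode_def sin_add sin_diff)
qed

text \<open>The bipartite symmetry of the path. It later matches the modes m - n, ..., m - 1 with 1,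
  ..., n at the cost of a parity sign.\<close>

lemma mode_reflect:
  assumes "c \<le> m" "m > 0"
  shows "mode m (m - c) x = (if even x then - 1 else 1) * mode m c x"
proof -
  have "pi * real (m - c) * real_of_int x / real m
      = pi * real_of_int x - pi * real c * real_of_int x / real m"
    using assms by (simp add: of_nat_diff field_simps)
  then show ?thesis
    unfolding mode_def by (simp add: sin_diff cos_pi_int sin_zero_iff_int2)
qed

subsection \<open>The determinant of the lowest modes\<close>

text \<open>Subtracting the right multiple of the monic Newton polynomial of degree i + 1 lowers the
  degree, and induction applies. The nodes are arbitrary and may coincide.\<close>

lemma newton_expansion:
  fixes p :: "'a::idom poly"
  assumes "degree p \<le> i"
  shows "\<exists>l. l i = coeff p i \<and> (\<forall>y. poly p y = (\<Sum>k\<le>i. l k * (\<Prod>h<k. y - x h)))"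
  using assms
proof (induction i arbitrary: p)
  case 0
  then obtain a where "p = [:a:]" by (metis degree_eq_zeroE le_zero_eq)
  then show ?case by (intro exI[of _ "\<lambda>_. a"]) simp
next
  case (Suc i)
  define N where "N = (\<Prod>h<Suc i. [:- x h, 1:])"
  have degN: "degree N = Suc i"
    unfolding N_def by (subst degree_prod_eq_sum_degree) auto
  moreover have "lead_coeff N = 1" unfolding N_def by (subst lead_coeff_prod) simp
  ultimately have coeffN: "coeff N (Suc i) = 1" by simp
  define q where "q = p - smult (coeff p (Suc i)) N"
  have "degree q \<le> i"
  proof (rule degree_le, intro allI impI)
    fix k assume "i < k"
    then show "coeff q k = 0"
      using degN coeffN Suc.prems
      by (cases "k = Suc i") (auto simp: q_def coeff_eq_0)
  qed
  with Suc.IH obtain l where l: "\<And>y. poly q y = (\<Sum>k\<le>i. l k * (\<Prod>h<k. y - x h))" by blast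
  have N: "poly N y = (\<Prod>h<Suc i. y - x h)" for y
    unfolding N_def poly_prod by (intro prod.cong) auto
  have "poly p y = poly q y + coeff p (Suc i) * poly N y" for y by (simp add: q_def)
  then show ?case
    by (intro exI[of _ "l(Suc i := coeff p (Suc i))"]) (simp add: l N)
qed

lemma det_mat_permutes:
  "det (mat n n (\<lambda>(i, j). b i j)) = (\<Sum>p | p permutes {0..<n}. signof p * (\<Prod>i=0..<n. b i (p i)))"
proof -
  have "(\<Prod>i=0..<n. mat n n (\<lambda>(i, j). b i j) $$ (i, p i)) = (\<Prod>i=0..<n. b i (p i))"
    if "p permutes {0..<n}" for p
    using permutes_in_image[OF that] by (intro prod.cong) auto
  then show ?thesis
    by (subst det_def'[of _ n]) (auto intro!: sum.cong)
qed

lemma det_cols_mul: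
  fixes a :: "nat \<Rightarrow> nat \<Rightarrow> 'a::comm_ring_1"
  shows "det (mat n n (\<lambda>(i, j). c j * a i j)) = (\<Prod>j<n. c j) * det (mat n n (\<lambda>(i, j). a i j))"
proof -
  have "(\<Prod>i=0..<n. c (p i) * a i (p i)) = (\<Prod>j<n. c j) * (\<Prod>i=0..<n. a i (p i))"
    if "p permutes {0..<n}" for p
    using prod.permute[OF that, of c] by (simp add: prod.distrib atLeast0LessThan)
  then show ?thesis
    unfolding det_mat_permutes sum_distrib_left by (intro sum.cong) (simp_all add: mult.left_commute)
qed

text \<open>In the Newton basis at the nodes \<open>y\<close> the matrix becomes upper triangular, and the change
  of basis is lower triangular.\<close>

lemma det_poly_values:
  fixes y :: "nat \<Rightarrow> 'a::idom"
  assumes "\<And>i. i < n \<Longrightarrow> degree (p i) \<le> i"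
  shows "det (mat n n (\<lambda>(i, j). poly (p i) (y j)))
    = (\<Prod>i<n. coeff (p i) i) * (\<Prod>t<n. \<Prod>h<t. y t - y h)"
proof -
  have "\<forall>i. \<exists>l. i < n \<longrightarrow> l i = coeff (p i) i \<and>
      (\<forall>z. poly (p i) z = (\<Sum>k\<le>i. l k * (\<Prod>h<k. z - y h)))"
    using newton_expansion assms by blast
  then obtain l where l: "\<And>i. i < n \<Longrightarrow> l i i = coeff (p i) i"
    "\<And>i z. i < n \<Longrightarrow> poly (p i) z = (\<Sum>k\<le>i. l i k * (\<Prod>h<k. z - y h))"
    by metis
  define L where "L = mat n n (\<lambda>(i, k). if k \<le> i then l i k else 0)"
  define N where "N = mat n n (\<lambda>(k, j). \<Prod>h<k. y j - y h)"
  have LN: "L \<in> carrier_mat n n" "N \<in> carrier_mat n n" by (simp_all add: L_def N_def)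
  have "mat n n (\<lambda>(i, j). poly (p i) (y j)) = L * N"
  proof (rule eq_matI)
    fix i j assume "i < dim_row (L * N)" "j < dim_col (L * N)"
    then have ij: "i < n" "j < n" by (simp_all add: L_def N_def)
    have "(\<Sum>k\<le>i. l i k * (\<Prod>h<k. y j - y h))
        = (\<Sum>k<n. if k \<le> i then l i k * (\<Prod>h<k. y j - y h) else 0)"
      using ij by (intro sum.mono_neutral_cong_left) auto
    then show "mat n n (\<lambda>(i, j). poly (p i) (y j)) $$ (i, j) = (L * N) $$ (i, j)"
      using ij by (simp add: L_def N_def scalar_prod_def l atLeast0LessThan
          if_distrib[of "\<lambda>x. x * _"] cong: if_cong)
  qed (simp_all add: L_def N_def)
  then have "det (mat n n (\<lambda>(i, j). poly (p i) (y j))) = det L * det N"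
    using det_mult LN by metis
  also have "det L = (\<Prod>i<n. coeff (p i) i)"
    using LN(1) by (subst det_lower_triangular[of n])
      (auto simp: L_def prod_list_diag_prod atLeast0LessThan l intro!: prod.cong)
  \<comment> \<open>Below the diagonal the factor \<open>h = j\<close> vanishes, because the nodes
    are the evaluation points themselves.\<close>
  also have "det N = (\<Prod>t<n. \<Prod>h<t. y t - y h)"
    using LN(2) by (subst det_upper_triangular[of _ n])
      (auto simp: N_def prod_list_diag_prod atLeast0LessThan upper_triangular_def intro!: prod.cong)
  finally show ?thesis .
qed

section \<open>Chebyshev polynomials of the second kind and the Slater determinant\<close>

fun chebyshev_U :: "nat \<Rightarrow> real poly" where
  "chebyshev_U 0 = 1"
| "chebyshev_U (Suc 0) = [:0, 2:]"
| "chebyshev_U (Suc (Suc k)) = [:0, 2:] * chebyshev_U (Suc k) - chebyshev_U k"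

text \<open>Turns mode i + 1 into a sine times a polynomial of degree i in the cosine, the shape
  that \<open>det_poly_values\<close> needs. The product form also covers the zeros of the
  sine.\<close>

lemma sin_times_poly_chebyshev_U:
  "sin \<theta> * poly (chebyshev_U k) (cos \<theta>) = sin (real (Suc k) * \<theta>)"
proof (induction k rule: chebyshev_U.induct)
  case 2
  then show ?case by (simp add: sin_double)
next
  case (3 k)
  have "sin (real (Suc (Suc (Suc k))) * \<theta>) + sin (real (Suc k) * \<theta>)
      = 2 * cos \<theta> * sin (real (Suc (Suc k)) * \<theta>)"
  proof -
    have "(real (Suc (Suc (Suc k))) * \<theta> + real (Suc k) * \<theta>) / 2 = real (Suc (Suc k)) * \<theta>"
      "(real (Suc (Suc (Suc k))) * \<theta> - real (Suc k) * \<theta>) / 2 = \<theta>"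
      by (simp_all add: field_simps)
    then show ?thesis by (simp only: sin_plus_sin) simp
  qed
  with 3 show ?case by (simp add: algebra_simps)
qed simp

lemma degree_chebyshev_U: "degree (chebyshev_U k) \<le> k"
proof (induction k rule: chebyshev_U.induct)
  case (3 k)
  then show ?case by (auto intro!: degree_diff_le degree_pCons_le[THEN order_trans])
qed simp_all

lemma coeff_chebyshev_U: "coeff (chebyshev_U k) k = 2 ^ k"
proof (induction k rule: chebyshev_U.induct)
  case (3 k)
  have "coeff (chebyshev_U k) (Suc (Suc k)) = 0"
    using degree_chebyshev_U[of k] by (intro coeff_eq_0) simp
  with 3 show ?case by simp
qed simp_all

text \<open>Modes index the rows and positions the columns: permuting modes permutes rows, and a
  sign that depends on the position alone is a column factor.\<close>

definition slater :: "nat \<Rightarrow> nat \<Rightarrow> (nat \<Rightarrow> nat) \<Rightarrow> (nat \<Rightarrow> int) \<Rightarrow> real" where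
  "slater n m K x = det (mat n n (\<lambda>(i, j). mode m (K i) (x j)))"

text \<open>Indices start at 0, so \<open>Suc\<close> selects the modes 1, ..., n. Once a sine is
  pulled out of each column, the Chebyshev polynomials leave a Vandermonde product in cosines, whose
  differences split into products of two sines.\<close>

lemma slater_Suc:
  "slater n m Suc x = 2 ^ (n * (n - 1))
    * (\<Prod>t<n. \<Prod>h<t. sin (pi * real_of_int (x h - x t) / (2 * real m)))
    * (\<Prod>t<n. \<Prod>h\<le>t. sin (pi * real_of_int (x h + x t) / (2 * real m)))"
proof -
  define \<theta> where "\<theta> j = pi * real_of_int (x j) / real m" for j
  define S where "S h t = sin (pi * real_of_int (x h - x t) / (2 * real m))" for h t
  define P where "P h t = sin (pi * real_of_int (x h + x t) / (2 * real m))" for h t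
  have "mode m (Suc i) (x j) = sin (\<theta> j) * poly (chebyshev_U i) (cos (\<theta> j))" for i j
    unfolding sin_times_poly_chebyshev_U by (simp add: mode_def \<theta>_def algebra_simps)
  then have "slater n m Suc x
      = (\<Prod>j<n. sin (\<theta> j)) * det (mat n n (\<lambda>(i, j). poly (chebyshev_U i) (cos (\<theta> j))))"
    unfolding slater_def by (simp only: det_cols_mul)
  also have "\<dots> = (\<Prod>j<n. sin (\<theta> j)) * ((\<Prod>i<n. 2 ^ i) * (\<Prod>t<n. \<Prod>h<t. cos (\<theta> t) - cos (\<theta> h)))"
    by (subst det_poly_values) (simp_all add: degree_chebyshev_U coeff_chebyshev_U)
  also have "(\<Prod>t<n. \<Prod>h<t. cos (\<theta> t) - cos (\<theta> h)) = (\<Prod>t<n. \<Prod>h<t. 2 * S h t * P h t)"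
    by (intro prod.cong refl, subst cos_diff_cos)
      (simp add: S_def P_def \<theta>_def ring_distribs add_divide_distrib diff_divide_distrib ac_simps)
  also have "\<dots> = (\<Prod>i<n. 2 ^ i) * (\<Prod>t<n. \<Prod>h<t. S h t) * (\<Prod>t<n. \<Prod>h<t. P h t)"
    by (simp add: prod.distrib)
  \<comment> \<open>The sines pulled out of the columns are the diagonal factors
    \<open>P j j\<close>. One power of 2 comes from the leading coefficients, an equal one from the
    differences of cosines.\<close>
  also have "(\<Prod>j<n. sin (\<theta> j)) * ((\<Prod>i<n. 2 ^ i) * \<dots>)
      = ((\<Prod>i<n. 2 ^ i) * (\<Prod>i<n. 2 ^ i)) * (\<Prod>t<n. \<Prod>h<t. S h t)
        * ((\<Prod>t<n. \<Prod>h<t. P h t) * (\<Prod>t<n. P t t))"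
    by (simp add: P_def \<theta>_def)
  also have "(\<Prod>t<n. \<Prod>h<t. P h t) * (\<Prod>t<n. P t t) = (\<Prod>t<n. \<Prod>h\<le>t. P h t)"
    by (simp add: prod.distrib[symmetric] lessThan_Suc_atMost[symmetric])
  also have "(\<Prod>i<n. 2 ^ i) * (\<Prod>i<n. 2 ^ i) = (2::real) ^ (n * (n - 1))"
  proof (induction n)
    case (Suc n)
    have "Suc n * (Suc n - 1) = n * (n - 1) + n + n" by (cases n) auto
    with Suc show ?case by (simp add: power_add)
  qed simp
  finally show ?thesis by (simp add: S_def P_def)
qed

subsection \<open>Walks in the alcove\<close>

lemma walks_0: "walks n R 0 a b = (if a = b \<and> a \<in> carrier_vec n \<and> a \<in> R then {[a]} else {})"
  unfolding walks_def by (auto simp: length_Suc_conv)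

lemma walks_start_in: "p \<in> walks n R k a b \<Longrightarrow> a \<in> R \<and> a \<in> carrier_vec n"
  unfolding walks_def by (auto simp: subset_iff)

lemma standard_steps_carrier: "s \<in> standard_steps n \<Longrightarrow> s \<in> carrier_vec n"
  unfolding standard_steps_def by auto

text \<open>Splitting off the first step fits the list representation and keeps the end point fixed
  while the start point varies, as in the later induction.\<close>

lemma walks_Suc:
  assumes a: "a \<in> R" "a \<in> carrier_vec n"
  shows "walks n R (Suc k) a b = (\<Union>s\<in>standard_steps n. (#) a ` walks n R k (a + s) b)"
proof (intro equalityI subsetI)
  fix p assume p: "p \<in> walks n R (Suc k) a b"
  then obtain q where q: "p = a # q" "length q = Suc k"
    unfolding walks_def by (auto simp: length_Suc_conv)
  have q0: "q ! 0 \<in> carrier_vec n" using p q unfolding walks_def by (auto simp: subset_iff)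
  define s where "s = q ! 0 - a"
  have "p ! 1 - p ! (1 - 1) \<in> standard_steps n"
    using p unfolding walks_def by (elim CollectE conjE) (erule bspec, simp)
  then have s: "s \<in> standard_steps n" by (simp add: s_def q)
  have "a + s = q ! 0" using q0 a by (intro eq_vecI) (auto simp: s_def)
  moreover have "q ! i - q ! (i - 1) \<in> standard_steps n" if "i \<in> {1..k}" for i
  proof -
    have "p ! (Suc i) - p ! (Suc i - 1) \<in> standard_steps n"
      using p that unfolding walks_def by (elim CollectE conjE) (erule bspec, simp)
    then show ?thesis using that q by (cases i) auto
  qed
  ultimately have "q \<in> walks n R k (a + s) b"
    using p q unfolding walks_def by auto
  with s q show "p \<in> (\<Union>s\<in>standard_steps n. (#) a ` walks n R k (a + s) b)" by blast
next
  fix p assume "p \<in> (\<Union>s\<in>standard_steps n. (#) a ` walks n R k (a + s) b)"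
  then obtain s q where s: "s \<in> standard_steps n" "p = a # q" "q \<in> walks n R k (a + s) b" by blast
  have "p ! i - p ! (i - 1) \<in> standard_steps n" if "i \<in> {1..Suc k}" for i
  proof (cases "i = 1")
    case True
    have "a + s - a = s" using a standard_steps_carrier[OF s(1)] by (intro eq_vecI) auto
    then show ?thesis using s True unfolding walks_def by auto
  next
    case False
    with that obtain j where "i = Suc (Suc j)" "j < k" by (cases i; cases "i - 1") auto
    then show ?thesis using s unfolding walks_def by (auto dest!: bspec[of _ _ "Suc j"])
  qed
  then show "p \<in> walks n R (Suc k) a b"
    using s a unfolding walks_def by auto
qed

lemma finite_standard_steps: "finite (standard_steps n)"
  unfolding standard_steps_def by auto

lemma finite_walks: "finite (walks n R k a b)"
proof (induction k arbitrary: a)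
  case 0
  then show ?case by (simp add: walks_0)
next
  case (Suc k)
  show ?case
  proof (cases "a \<in> R \<and> a \<in> carrier_vec n")
    case True
    then show ?thesis using Suc finite_standard_steps by (simp add: walks_Suc)
  next
    case False
    then have "walks n R (Suc k) a b = {}" using walks_start_in by blast
    then show ?thesis by simp
  qed
qed

text \<open>The 2n steps are pairwise distinct: the only nonzero coordinate identifies the axis and
  its sign the direction.\<close>

lemma sum_standard_steps:
  "sum f (standard_steps n) = (\<Sum>i<n. f (unit_vec n i) + f (- unit_vec n i))"
  for f :: "real vec \<Rightarrow> 'a::comm_monoid_add"
proof -
  have nth: "unit_vec n i $ i = (1::real)" "(- unit_vec n i) $ i = (-1::real)"
    "j \<noteq> i \<Longrightarrow> unit_vec n j $ i = (0::real)" "j \<noteq> i \<Longrightarrow> (- unit_vec n j) $ i = (0::real)"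
    if "i < n" "j < n" for i j
    using that by auto
  have disj: "{unit_vec n i, - unit_vec n i} \<inter> {unit_vec n j, - unit_vec n j} = ({} :: real vec set)"
    if "i < n" "j < n" "i \<noteq> j" for i j
  proof (rule ccontr)
    assume "\<not> ?thesis"
    then obtain v :: "real vec" where "v \<in> {unit_vec n i, - unit_vec n i}" "v \<in> {unit_vec n j, - unit_vec n j}"
      by blast
    then have "v $ i \<noteq> 0" "v $ i = 0"
      using nth(1,2)[of i i] nth(3,4)[of i j] that by (metis insertE empty_iff zero_neq_one neg_equal_0_iff_equal)+
    then show False by simp
  qed
  have "unit_vec n i \<noteq> (- unit_vec n i :: real vec)" if "i < n" for i
    using nth[of i i] that by (metis one_neq_neg_one)
  then have "sum f {unit_vec n i, - unit_vec n i} = f (unit_vec n i) + f (- unit_vec n i)" if "i < n" for i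
    using that by simp
  then show ?thesis
    unfolding standard_steps_def using disj by (subst sum.UNION_disjoint) auto
qed

lemma card_walks_Suc:
  assumes a: "a \<in> R" "a \<in> carrier_vec n"
  shows "card (walks n R (Suc k) a b)
    = (\<Sum>i<n. card (walks n R k (a + unit_vec n i) b) + card (walks n R k (a + - unit_vec n i) b))"
proof -
  have "(#) a ` walks n R k (a + s) b \<inter> (#) a ` walks n R k (a + s') b = {}"
    if "s \<in> standard_steps n" "s' \<in> standard_steps n" "s \<noteq> s'" for s s'
  proof -
    have "a + s \<noteq> a + s'"
    proof
      assume "a + s = a + s'"
      then have eq: "(a + s) $ i = (a + s') $ i" for i by simp
      have "s $ i = s' $ i" if "i < n" for i
        using eq[of i] a \<open>s \<in> _\<close>[THEN standard_steps_carrier] \<open>s' \<in> _\<close>[THEN standard_steps_carrier] that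
        by simp
      then have "s = s'"
        using that(1,2)[THEN standard_steps_carrier] by (intro eq_vecI) auto
      with that show False by simp
    qed
    then show ?thesis unfolding walks_def by auto
  qed
  then have "card (walks n R (Suc k) a b) = (\<Sum>s\<in>standard_steps n. card ((#) a ` walks n R k (a + s) b))"
    unfolding walks_Suc[OF a] using finite_walks finite_standard_steps by (subst card_UN_disjoint) auto
  also have "\<dots> = (\<Sum>s\<in>standard_steps n. card (walks n R k (a + s) b))"
    by (intro sum.cong refl card_image) simp
  finally show ?thesis by (simp only: sum_standard_steps)
qed

section \<open>Integer coordinates for the points of the alcove\<close>

definition embed :: "nat \<Rightarrow> (nat \<Rightarrow> int) \<Rightarrow> real vec" where
  "embed n x = vec n (\<lambda>i. real_of_int (x i))"

definition in_alcove :: "nat \<Rightarrow> nat \<Rightarrow> (nat \<Rightarrow> int) \<Rightarrow> bool" where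
  "in_alcove n m x \<longleftrightarrow> x 0 < int m \<and> (\<forall>i. i + 1 < n \<longrightarrow> x (i + 1) < x i) \<and> 0 < x (n - 1)"

lemma embed_carrier [simp]: "embed n x \<in> carrier_vec n"
  by (simp add: embed_def)

lemma embed_in_alcove: "n > 0 \<Longrightarrow> embed n x \<in> alcove n m \<longleftrightarrow> in_alcove n m x"
  unfolding alcove_def in_alcove_def embed_def by auto

lemma embed_add_unit:
  "i < n \<Longrightarrow> embed n x + unit_vec n i = embed n (x(i := x i + 1))"
  "i < n \<Longrightarrow> embed n x + - unit_vec n i = embed n (x(i := x i - 1))"
  by (auto intro!: eq_vecI simp: embed_def)

lemma card_walks_alcove_Suc:
  assumes "n > 0" "in_alcove n m x"
  shows "card (walks n (alcove n m) (Suc k) (embed n x) b)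
    = (\<Sum>i<n. card (walks n (alcove n m) k (embed n (x(i := x i + 1))) b)
           + card (walks n (alcove n m) k (embed n (x(i := x i - 1))) b))"
  using assms by (subst card_walks_Suc) (auto simp: embed_in_alcove embed_add_unit)

lemma in_alcove_strict_antimono:
  assumes "in_alcove n m x" "i < j" "j < n"
  shows "x j < x i"
  using assms(2,3)
proof (induction j rule: less_induct)
  case (less j)
  then obtain l where l: "j = Suc l" by (cases j) auto
  have "x j < x l" using assms(1) less.prems l by (simp add: in_alcove_def)
  moreover have "x l \<le> x i" using less l by (cases "i = l") (auto simp: less_imp_le)
  ultimately show ?case by simp
qed

lemma in_alcove_bounds:
  assumes "in_alcove n m x" "i < n"
  shows "0 < x i" "x i < int m"
proof -
  have "i = n - 1 \<or> i < n - 1" using assms(2) by linarith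
  then have "x (n - 1) \<le> x i"
    using in_alcove_strict_antimono[of n m x i "n - 1"] assms(1)
    by fastforce
  then show "0 < x i" using assms by (simp add: in_alcove_def)
  have "x i \<le> x 0"
    using in_alcove_strict_antimono[of n m x 0 i] assms by (cases "i = 0") auto
  then show "x i < int m" using assms by (simp add: in_alcove_def)
qed

text \<open>Pigeonhole: the coordinates are n distinct integers between 1 and m - 1. This leaves the
  two cases m = n + 1 and m > n + 1 of the theorem.\<close>

lemma in_alcove_imp_less:
  assumes "n > 0" "in_alcove n m x"
  shows "n < m"
proof -
  have "inj_on x {..<n}"
    using in_alcove_strict_antimono[OF assms(2)] by (intro linorder_inj_onI) force+
  moreover have "x ` {..<n} \<subseteq> {1..<int m}"
    using in_alcove_bounds[OF assms(2)] by force
  ultimately have "card {..<n} \<le> card {1..<int m}"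
    by (intro card_inj_on_le) auto
  then show ?thesis using in_alcove_bounds[OF assms(2,1)] by simp
qed

text \<open>A unit step between integer points cannot jump over a wall. A walker that leaves the
  alcove therefore lands exactly where the spectral sum vanishes.\<close>

lemma neighbour_on_wall:
  assumes "in_alcove n m x" "i < n" "d \<in> {1, -1}" "\<not> in_alcove n m (x(i := x i + d))"
  shows "\<exists>j<n. (x(i := x i + d)) j \<in> {0, int m} \<or> (\<exists>l<n. l \<noteq> j \<and> (x(i := x i + d)) l = (x(i := x i + d)) j)"
proof -
  let ?y = "x(i := x i + d)"
  consider "?y 0 \<ge> int m" | j where "j + 1 < n" "?y j \<le> ?y (j + 1)" | "?y (n - 1) \<le> 0"
    using assms(4) unfolding in_alcove_def by (meson not_le)
  then show ?thesis
  proof cases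
    case 1
    moreover have "x 0 < int m" using assms by (simp add: in_alcove_def)
    ultimately have "?y 0 = int m" using assms(3) by (auto split: if_splits)
    then show ?thesis using assms(2) by (intro exI[of _ 0]) auto
  next
    case 2
    moreover have "x (j + 1) < x j" using assms(1) 2 by (simp add: in_alcove_def)
    ultimately have "?y (j + 1) = ?y j" using assms(3) by (auto split: if_splits)
    then have "\<exists>l<n. l \<noteq> j \<and> ?y l = ?y j" using 2(1) by (intro exI[of _ "j + 1"]) simp
    then show ?thesis using 2(1) by (intro exI[of _ j]) auto
  next
    case 3
    moreover have "0 < x (n - 1)" using assms by (simp add: in_alcove_def)
    ultimately have "?y (n - 1) = 0" using assms(3) by (auto split: if_splits)
    then show ?thesis using assms(2) by (intro exI[of _ "n - 1"]) auto
  qed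
qed

subsection \<open>The spectral sum\<close>

lemma slater_cong: "(\<And>i. i < n \<Longrightarrow> K i = K' i) \<Longrightarrow> slater n m K x = slater n m K' x"
  unfolding slater_def by (intro arg_cong[of _ _ det]) (auto intro!: eq_matI)

lemma slater_permute:
  assumes "p permutes {..<n}"
  shows "slater n m (\<lambda>i. K (p i)) x = signof p * slater n m K x"
proof -
  have "mat n n (\<lambda>(i, j). mat n n (\<lambda>(i, j). mode m (K i) (x j)) $$ (p i, j))
      = mat n n (\<lambda>(i, j). mode m (K (p i)) (x j))"
    using permutes_in_image[OF assms] by (intro eq_matI) auto
  then show ?thesis
    unfolding slater_def
    using det_permute_rows[of "mat n n (\<lambda>(i, j). mode m (K i) (x j))" n p] assms
    by (simp add: atLeast0LessThan)
qed

text \<open>Pauli exclusion: a repeated mode gives equal rows. Non-injective choices can thus remain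
  in the spectral sum, whose index set is then a full product.\<close>

lemma slater_not_inj:
  assumes "\<not> inj_on K {..<n}"
  shows "slater n m K x = 0"
proof -
  obtain i j where "i < n" "j < n" "i \<noteq> j" "K i = K j"
    using assms by (auto simp: inj_on_def)
  then show ?thesis
    unfolding slater_def by (intro det_identical_rows[of _ n i j]) (auto intro!: eq_vecI)
qed

definition energy :: "nat \<Rightarrow> nat \<Rightarrow> (nat \<Rightarrow> nat) \<Rightarrow> real" where
  "energy n m K = (\<Sum>i<n. 2 * cos (pi * real (K i) / real m))"

definition weight :: "nat \<Rightarrow> nat \<Rightarrow> (nat \<Rightarrow> nat) \<Rightarrow> (nat \<Rightarrow> int) \<Rightarrow> (nat \<Rightarrow> int) \<Rightarrow> real" where
  "weight n m K x y = (\<Prod>i<n. mode m (K i) (x i)) * slater n m K y"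

text \<open>Extensional functions make the set finite and let a sum over it of products factorise
  into sums over single modes.\<close>

definition mode_choices :: "nat \<Rightarrow> nat \<Rightarrow> (nat \<Rightarrow> nat) set" where
  "mode_choices n m = {..<n} \<rightarrow>\<^sub>E {1..<m}"

text \<open>Each coordinate brings one factor 2/m, the normalisation in
  \<open>mode_orthogonal\<close>.\<close>

definition spectral_sum :: "nat \<Rightarrow> nat \<Rightarrow> nat \<Rightarrow> (nat \<Rightarrow> int) \<Rightarrow> (nat \<Rightarrow> int) \<Rightarrow> real" where
  "spectral_sum n m k x y
    = (2 / real m) ^ n * (\<Sum>K\<in>mode_choices n m. energy n m K ^ k * weight n m K x y)"

lemma finite_mode_choices [simp]: "finite (mode_choices n m)"
  by (simp add: mode_choices_def finite_PiE)

text \<open>A step changes one coordinate of \<open>x\<close>, hence a single factor of the plain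
  product in \<open>weight\<close>. The eigenvalue equation for that factor, summed over the
  coordinates, yields the energy.\<close>

lemma spectral_sum_Suc:
  "spectral_sum n m (Suc k) x y
    = (\<Sum>i<n. spectral_sum n m k (x(i := x i + 1)) y + spectral_sum n m k (x(i := x i - 1)) y)"
proof -
  have upd: "(\<Prod>j<n. mode m (K j) ((x(i := z)) j)) = mode m (K i) z * (\<Prod>j\<in>{..<n} - {i}. mode m (K j) (x j))"
    if "i < n" for i z K
  proof -
    have "(\<Prod>j\<in>{..<n} - {i}. mode m (K j) ((x(i := z)) j)) = (\<Prod>j\<in>{..<n} - {i}. mode m (K j) (x j))"
      by (intro prod.cong) auto
    then show ?thesis using that by (subst prod.remove[of _ i]) auto
  qed
  have nb: "weight n m K (x(i := x i + 1)) y + weight n m K (x(i := x i - 1)) y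
      = 2 * cos (pi * real (K i) / real m) * weight n m K x y" if "i < n" for i K
  proof -
    have "weight n m K (x(i := x i + 1)) y + weight n m K (x(i := x i - 1)) y
        = (mode m (K i) (x i + 1) + mode m (K i) (x i - 1))
          * (\<Prod>j\<in>{..<n} - {i}. mode m (K j) (x j)) * slater n m K y"
      unfolding weight_def upd[OF that] by (simp add: algebra_simps)
    also have "\<dots> = 2 * cos (pi * real (K i) / real m)
        * (mode m (K i) (x i) * (\<Prod>j\<in>{..<n} - {i}. mode m (K j) (x j))) * slater n m K y"
      unfolding mode_neighbours by simp
    also have "mode m (K i) (x i) * (\<Prod>j\<in>{..<n} - {i}. mode m (K j) (x j)) = (\<Prod>j<n. mode m (K j) (x j))"
      using that by (subst (2) prod.remove[of _ i]) auto
    finally show ?thesis by (simp add: weight_def)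
  qed
  have "energy n m K ^ Suc k * weight n m K x y
      = (\<Sum>i<n. energy n m K ^ k * weight n m K (x(i := x i + 1)) y
             + energy n m K ^ k * weight n m K (x(i := x i - 1)) y)" for K
  proof -
    have "energy n m K ^ Suc k * weight n m K x y
        = energy n m K ^ k * ((\<Sum>i<n. 2 * cos (pi * real (K i) / real m)) * weight n m K x y)"
      by (simp add: energy_def)
    also have "\<dots> = (\<Sum>i<n. energy n m K ^ k * (2 * cos (pi * real (K i) / real m) * weight n m K x y))"
      unfolding sum_distrib_left sum_distrib_right ..
    also have "\<dots> = (\<Sum>i<n. energy n m K ^ k * weight n m K (x(i := x i + 1)) y
             + energy n m K ^ k * weight n m K (x(i := x i - 1)) y)"
      by (intro sum.cong refl) (simp only: nb[symmetric] lessThan_iff distrib_left)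
    finally show ?thesis .
  qed
  then have "spectral_sum n m (Suc k) x y = (2 / real m) ^ n * (\<Sum>K\<in>mode_choices n m. \<Sum>i<n.
      energy n m K ^ k * weight n m K (x(i := x i + 1)) y + energy n m K ^ k * weight n m K (x(i := x i - 1)) y)"
    by (simp add: spectral_sum_def)
  then show ?thesis
    by (subst (asm) sum.swap) (simp add: spectral_sum_def sum_distrib_left sum.distrib distrib_left)
qed

lemma spectral_sum_boundary:
  assumes "j < n" "x j \<in> {0, int m}"
  shows "spectral_sum n m k x y = 0"
proof -
  have "(\<Prod>i<n. mode m (K i) (x i)) = 0" for K
    using assms by (auto intro!: prod_zero bexI[of _ j])
  then show ?thesis by (simp only: spectral_sum_def weight_def mult_zero_left mult_zero_right sum.neutral_const)
qed

text \<open>Exchanging the modes of the two coinciding coordinates changes the sign of every summand.\<close>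

lemma spectral_sum_coincidence:
  assumes "j < n" "l < n" "l \<noteq> j" "x l = x j"
  shows "spectral_sum n m k x y = 0"
proof -
  define \<tau> where "\<tau> = Transposition.transpose l j"
  have \<tau>: "\<tau> permutes {..<n}" unfolding \<tau>_def using assms by (intro permutes_swap_id) auto
  have \<tau>\<tau>: "\<tau> (\<tau> i) = i" for i by (simp add: \<tau>_def)
  have x\<tau>: "x (\<tau> i) = x i" for i using assms by (simp add: \<tau>_def Transposition.transpose_def)
  have sign: "signof \<tau> = (- 1 :: real)" using assms by (simp add: \<tau>_def sign_swap_id)
  define F where "F K = energy n m K ^ k * weight n m K x y" for K
  have F: "F (\<lambda>i. K (\<tau> i)) = - F K" for K
  proof -
    have "energy n m (\<lambda>i. K (\<tau> i)) = energy n m K"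
      unfolding energy_def by (subst sum.permute[OF \<tau>]) (simp add: o_def \<tau>\<tau>)
    moreover have "(\<Prod>i<n. mode m (K (\<tau> i)) (x i)) = (\<Prod>i<n. mode m (K i) (x i))"
      by (subst prod.permute[OF \<tau>]) (simp add: o_def \<tau>\<tau> x\<tau>)
    ultimately show ?thesis by (simp add: F_def weight_def slater_permute[OF \<tau>] sign)
  qed
  have mem: "(\<lambda>i. K (\<tau> i)) \<in> mode_choices n m" if "K \<in> mode_choices n m" for K
    using that permutes_in_image[OF \<tau>] unfolding mode_choices_def by (auto simp: PiE_iff extensional_def)
  have "sum F (mode_choices n m) = (\<Sum>K\<in>mode_choices n m. F (\<lambda>i. K (\<tau> i)))"
    by (rule sum.reindex_bij_witness[of _ "\<lambda>K i. K (\<tau> i)" "\<lambda>K i. K (\<tau> i)"]) (auto simp: \<tau>\<tau> mem)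
  also have "\<dots> = - sum F (mode_choices n m)" by (simp add: F sum_negf)
  finally show ?thesis by (simp add: spectral_sum_def F_def[abs_def])
qed

text \<open>Both sequences decrease strictly, so \<open>p\<close> must be increasing, and an
  increasing permutation of an initial segment is the identity.\<close>

lemma strictly_decreasing_permuted:
  fixes x y :: "nat \<Rightarrow> int"
  assumes p: "p permutes {0..<n}"
    and x: "\<And>i j. i < j \<Longrightarrow> j < n \<Longrightarrow> x j < x i" and y: "\<And>i j. i < j \<Longrightarrow> j < n \<Longrightarrow> y j < y i"
    and eq: "\<And>i. i < n \<Longrightarrow> x i = y (p i)"
  shows "p = id"
proof (rule permutes_natset_ge)
  show "\<forall>i\<in>{0..<n}. i \<le> p i"
  proof
    fix i assume "i \<in> {0..<n}"
    then show "i \<le> p i"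
    proof (induction i)
      case (Suc i)
      have lt: "p i < n" "p (Suc i) < n" using permutes_in_image[OF p] Suc.prems by (metis Suc_lessD atLeastLessThan_iff zero_le)+
      have "y (p (Suc i)) < y (p i)" using x[of i "Suc i"] eq[of i] eq[of "Suc i"] Suc.prems by simp
      then have "p i < p (Suc i)" using y[of "p (Suc i)" "p i"] lt by (metis less_asym nat_neq_iff)
      with Suc show ?case by simp
    qed simp
  qed
qed (rule p)

text \<open>Once the determinant is expanded, the sum over all choices factorises into n
  completeness relations, which force x i = y (p i). For two points of the alcove only the identity
  permutation survives.\<close>

lemma spectral_sum_0:
  assumes x: "in_alcove n m x" and y: "in_alcove n m y"
  shows "spectral_sum n m 0 x y = (if \<forall>i<n. x i = y i then 1 else 0)"
proof -
  have lt: "p i < n" if "p permutes {0..<n}" "i < n" for p i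
    using permutes_in_image[OF that(1), of i] that(2) by simp
  have "spectral_sum n m 0 x y = (2 / real m) ^ n * (\<Sum>K\<in>mode_choices n m. \<Sum>p | p permutes {0..<n}.
      signof p * (\<Prod>i<n. mode m (K i) (x i) * mode m (K i) (y (p i))))"
    unfolding spectral_sum_def weight_def slater_def det_mat_permutes
    by (simp add: sum_distrib_left prod.distrib ac_simps atLeast0LessThan)
  also have "\<dots> = (\<Sum>p | p permutes {0..<n}. signof p * ((2 / real m) ^ n
      * (\<Sum>K\<in>mode_choices n m. \<Prod>i<n. mode m (K i) (x i) * mode m (K i) (y (p i)))))"
    by (subst sum.swap) (simp add: sum_distrib_left ac_simps)
  also have "\<dots> = (\<Sum>p | p permutes {0..<n}. signof p * (\<Prod>i<n.
      2 / real m * (\<Sum>c\<in>{1..<m}. mode m c (x i) * mode m c (y (p i)))))"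
    unfolding mode_choices_def prod.distrib[of "\<lambda>_. 2 / real m"]
    by (subst prod_sum_PiE) simp_all
  also have "\<dots> = (\<Sum>p | p permutes {0..<n}. signof p * (\<Prod>i<n. if x i = y (p i) then 1 else 0))"
    using in_alcove_bounds[OF x] in_alcove_bounds[OF y] lt
    by (intro sum.cong prod.cong refl arg_cong2[of _ _ _ _ "(*)"] mode_orthogonal) auto
  also have "\<dots> = (\<Sum>p | p permutes {0..<n}. if p = id then (if \<forall>i<n. x i = y i then 1 else 0) else 0)"
  proof (intro sum.cong refl)
    fix p assume "p \<in> {p. p permutes {0..<n}}"
    then have p: "p permutes {0..<n}" by simp
    show "signof p * (\<Prod>i<n. if x i = y (p i) then 1 else (0::real))
        = (if p = id then (if \<forall>i<n. x i = y i then 1 else 0) else 0)"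
    proof (cases "\<forall>i<n. x i = y (p i)")
      case True
      then have "p = id"
        using in_alcove_strict_antimono[OF x] in_alcove_strict_antimono[OF y]
        by (intro strictly_decreasing_permuted[OF p, of x y]) auto
      with True show ?thesis by simp
    next
      case False
      then have "(\<Prod>i<n. if x i = y (p i) then 1 else (0::real)) = 0" by auto
      with False show ?thesis by auto
    qed
  qed
  also have "\<dots> = (if \<forall>i<n. x i = y i then 1 else 0)"
    using permutes_id[of "{0..<n}"] by (simp add: finite_permutations)
  finally show ?thesis .
qed

text \<open>Both sides obey the same recursion in the start point. The spectral one runs over all 2n
  neighbours, but a neighbour outside the alcove has no walks and lies on a wall, so it contributes
  0 to both.\<close>

lemma card_walks_eq_spectral_sum:
  assumes n: "n > 0" and y: "in_alcove n m y" and x: "in_alcove n m x"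
  shows "real (card (walks n (alcove n m) k (embed n x) (embed n y))) = spectral_sum n m k x y"
  using x
proof (induction k arbitrary: x)
  case 0
  have "embed n x = embed n y \<longleftrightarrow> (\<forall>i<n. x i = y i)"
    unfolding embed_def by (auto simp: vec_eq_iff)
  then show ?case using 0 n y by (auto simp: walks_0 embed_in_alcove spectral_sum_0)
next
  case (Suc k)
  have "real (card (walks n (alcove n m) k (embed n (x(i := x i + d))) (embed n y)))
      = spectral_sum n m k (x(i := x i + d)) y" if "i < n" "d \<in> {1, -1}" for i d
  proof (cases "in_alcove n m (x(i := x i + d))")
    case True
    then show ?thesis by (rule Suc.IH)
  next
    case False
    then have "embed n (x(i := x i + d)) \<notin> alcove n m" using n by (simp add: embed_in_alcove)
    then have "walks n (alcove n m) k (embed n (x(i := x i + d))) (embed n y) = {}"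
      using walks_start_in by blast
    moreover have "spectral_sum n m k (x(i := x i + d)) y = 0"
      using neighbour_on_wall[OF Suc.prems that False] spectral_sum_boundary spectral_sum_coincidence
      by metis
    ultimately show ?thesis by simp
  qed
  from this[of _ 1] this[of _ "-1"] show ?case
    using Suc.prems n by (simp add: card_walks_alcove_Suc spectral_sum_Suc)
qed

subsection \<open>Extremal energies\<close>

text \<open>Exchange argument: \<open>S - {1..n}\<close> and \<open>{1..n} - S\<close> have equal
  size, and f n strictly exceeds f on the first and is at most f on the second.\<close>

lemma sum_less_sum_initial:
  fixes f :: "nat \<Rightarrow> real"
  assumes "n < m" and dec: "\<And>a b. 1 \<le> a \<Longrightarrow> a < b \<Longrightarrow> b < m \<Longrightarrow> f b < f a"
    and S: "S \<subseteq> {1..<m}" "card S = n" "S \<noteq> {1..n}"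
  shows "sum f S < sum f {1..n}"
proof -
  have finS: "finite S" using S finite_subset by blast
  have card_eq: "card (S - {1..n}) = card ({1..n} - S)"
    using S finS by (simp add: card_Diff_subset_Int Int_commute)
  have ne: "S - {1..n} \<noteq> {}"
  proof
    assume "S - {1..n} = {}"
    then have "S \<subseteq> {1..n}" by blast
    with S show False by (metis card_atLeastAtMost card_subset_eq diff_Suc_1 finite_atLeastAtMost)
  qed
  have n: "1 \<le> n" using ne S finS by (cases n) auto
  have "sum f (S - {1..n}) < (\<Sum>i\<in>S - {1..n}. f n)"
    using ne finS S n by (intro sum_strict_mono) (auto intro!: dec)
  also have "\<dots> = (\<Sum>i\<in>{1..n} - S. f n)" using card_eq by simp
  also have "\<dots> \<le> sum f ({1..n} - S)"
  proof (intro sum_mono)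
    fix i assume "i \<in> {1..n} - S"
    then show "f n \<le> f i" using dec[of i n] \<open>n < m\<close> by (cases "i = n") auto
  qed
  finally have "sum f (S - {1..n}) < sum f ({1..n} - S)" .
  moreover have "sum f S = sum f (S - {1..n}) + sum f (S \<inter> {1..n})"
    using finS by (metis sum.Int_Diff add.commute)
  moreover have "sum f {1..n} = sum f ({1..n} - S) + sum f (S \<inter> {1..n})"
    by (metis sum.Int_Diff add.commute finite_atLeastAtMost Int_commute)
  ultimately show ?thesis by simp
qed

text \<open>Choices are ordered, so for n < m this set holds all n! orderings of the modes 1, ...,
  n.\<close>

definition ground :: "nat \<Rightarrow> nat \<Rightarrow> (nat \<Rightarrow> nat) set" where
  "ground n m = {K \<in> mode_choices n m. inj_on K {..<n} \<and> K ` {..<n} = {1..n}}"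

definition top_choices :: "nat \<Rightarrow> nat \<Rightarrow> (nat \<Rightarrow> nat) set" where
  "top_choices n m = {K \<in> mode_choices n m. inj_on K {..<n} \<and> K ` {..<n} = {m - n..<m}}"

lemma energy_inj:
  "inj_on K {..<n} \<Longrightarrow> energy n m K = 2 * (\<Sum>c\<in>K ` {..<n}. cos (pi * real c / real m))"
  by (simp add: energy_def sum.reindex sum_distrib_left)

lemma Suc_image_lessThan: "Suc ` {..<n} = {1..n}"
  by (simp add: lessThan_atLeast0 image_Suc_atLeastLessThan atLeastLessThanSuc_atLeastAtMost)

lemma image_reflect_initial:
  fixes n m :: nat
  assumes "n < m"
  shows "(\<lambda>c. m - c) ` {1..n} = {m - n..<m}"
proof (intro equalityI subsetI)
  fix c assume "c \<in> {m - n..<m}"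
  then have "c = m - (m - c)" "m - c \<in> {1..n}"
    using assms by (simp_all only: atLeastAtMost_iff atLeastLessThan_iff) arith+
  then show "c \<in> (\<lambda>c. m - c) ` {1..n}" by (rule image_eqI)
qed (use assms in auto)

lemma image_reflect_reflect:
  fixes S :: "nat set"
  assumes "S \<subseteq> {..m}"
  shows "(\<lambda>c. m - c) ` (\<lambda>c. m - c) ` S = S"
proof -
  have "(\<lambda>c. m - (m - c)) ` S = (\<lambda>c. c) ` S" using assms by (intro image_cong) auto
  then show ?thesis by (simp add: image_image)
qed

lemma energy_ground:
  assumes "K \<in> ground n m"
  shows "energy n m K = energy n m Suc"
  using assms by (simp add: ground_def energy_inj Suc_image_lessThan)

text \<open>The ground choices are the permutations of one mode set. Reordering the rows of the
  determinant in \<open>y\<close> yields the sign that turns the plain products in \<open>x\<close>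
  into a Leibniz expansion.\<close>

lemma sum_weight_ground:
  assumes "n < m"
  shows "(\<Sum>K\<in>ground n m. weight n m K x y) = slater n m Suc x * slater n m Suc y"
proof -
  have lt: "p i < n" if "p permutes {..<n}" "i < n" for p i
    using permutes_in_image[OF that(1), of i] that(2) by simp
  have Suc_pred: "Suc (K i - Suc 0) = K i" "K i - Suc 0 < n" if "K \<in> ground n m" "i < n" for K i
  proof -
    have "K i \<in> K ` {..<n}" using that by simp
    then have "1 \<le> K i" "K i \<le> n" using that by (auto simp: ground_def)
    then show "Suc (K i - Suc 0) = K i" "K i - Suc 0 < n" by auto
  qed
  have perm: "(\<lambda>i. if i < n then K i - 1 else i) permutes {..<n}" if K: "K \<in> ground n m" for K
  proof (rule bij_imp_permutes)
    have "inj_on (\<lambda>i. if i < n then K i - 1 else i) {..<n}"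
    proof (rule inj_onI)
      fix i j assume "i \<in> {..<n}" "j \<in> {..<n}"
        "(if i < n then K i - 1 else i) = (if j < n then K j - 1 else j)"
      then have ij: "i < n" "j < n" "K i - Suc 0 = K j - Suc 0" by simp_all
      then have "K i = K j" using Suc_pred(1)[OF K] by metis
      with ij show "i = j" using K by (auto simp: ground_def inj_on_def)
    qed
    moreover have "(\<lambda>i. if i < n then K i - 1 else i) ` {..<n} \<subseteq> {..<n}"
      using Suc_pred(2)[OF K] by auto
    ultimately show "bij_betw (\<lambda>i. if i < n then K i - 1 else i) {..<n} {..<n}"
      unfolding bij_betw_def by (intro conjI endo_inj_surj) auto
  qed simp
  have mem: "(\<lambda>i\<in>{..<n}. Suc (p i)) \<in> ground n m" if p: "p permutes {..<n}" for p
  proof -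
    have "(\<lambda>i\<in>{..<n}. Suc (p i)) ` {..<n} = Suc ` p ` {..<n}" by auto
    also have "\<dots> = {1..n}"
      using permutes_image[OF p] by (simp add: Suc_image_lessThan)
    finally have img: "(\<lambda>i\<in>{..<n}. Suc (p i)) ` {..<n} = {1..n}" .
    have "Suc (p i) \<in> {1..<m}" if "i < n" for i using lt[OF p that] assms by simp
    then have "(\<lambda>i\<in>{..<n}. Suc (p i)) \<in> mode_choices n m" by (simp add: mode_choices_def)
    moreover have "inj_on (\<lambda>i\<in>{..<n}. Suc (p i)) {..<n}"
      using permutes_inj[OF p] by (intro inj_onI) (auto dest: injD)
    ultimately show ?thesis using img by (simp add: ground_def)
  qed
  have "(\<Sum>K\<in>ground n m. weight n m K x y)
      = (\<Sum>p | p permutes {..<n}. weight n m (\<lambda>i\<in>{..<n}. Suc (p i)) x y)"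
  \<comment> \<open>The bijection is a shift by one. From index n on, a permutation must be the
    identity, whereas a choice must be \<open>undefined\<close>.\<close>
  proof (rule sum.reindex_bij_witness[of _ "\<lambda>p. \<lambda>i\<in>{..<n}. Suc (p i)" "\<lambda>K i. if i < n then K i - 1 else i"])
    fix K assume K: "K \<in> ground n m"
    then have ext: "K \<in> extensional {..<n}" by (simp add: ground_def mode_choices_def PiE_def)
    show "(\<lambda>i\<in>{..<n}. Suc (if i < n then K i - 1 else i)) = K"
    proof
      fix i
      show "(\<lambda>i\<in>{..<n}. Suc (if i < n then K i - 1 else i)) i = K i"
        using Suc_pred(1)[OF K, of i] extensional_arb[OF ext, of i] by (cases "i < n") simp_all
    qed
    then show "weight n m (\<lambda>i\<in>{..<n}. Suc (if i < n then K i - 1 else i)) x y = weight n m K x y"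
      by simp
  qed (use perm mem in \<open>auto simp: permutes_def fun_eq_iff\<close>)
  also have "\<dots> = (\<Sum>p | p permutes {..<n}. signof p * (\<Prod>i<n. mode m (Suc (p i)) (x i)) * slater n m Suc y)"
  proof (intro sum.cong refl)
    fix p assume "p \<in> {p. p permutes {..<n}}"
    then have p: "p permutes {..<n}" by simp
    have "slater n m (\<lambda>i\<in>{..<n}. Suc (p i)) y = slater n m (\<lambda>i. Suc (p i)) y"
      by (intro slater_cong) simp
    then show "weight n m (\<lambda>i\<in>{..<n}. Suc (p i)) x y
        = signof p * (\<Prod>i<n. mode m (Suc (p i)) (x i)) * slater n m Suc y"
      by (simp add: weight_def slater_permute[OF p])
  qed
  also have "\<dots> = (\<Sum>p | p permutes {..<n}. signof p * (\<Prod>i<n. mode m (Suc (p i)) (x i))) * slater n m Suc y"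
    by (simp add: sum_distrib_right)
  \<comment> \<open>Here the permutation acts on the row index, hence the column form of the
    expansion.\<close>
  also have "(\<Sum>p | p permutes {..<n}. signof p * (\<Prod>i<n. mode m (Suc (p i)) (x i))) = slater n m Suc x"
    unfolding slater_def using lt
    by (subst det_col[of _ n]) (auto simp: atLeast0LessThan intro!: sum.cong prod.cong)
  finally show ?thesis .
qed

lemma prod_parity_sign:
  fixes x :: "nat \<Rightarrow> int"
  assumes "finite A"
  shows "(\<Prod>i\<in>A. if even (x i) then - 1 else 1) = (- 1) ^ card A * (if even (sum x A) then 1 else (- 1 :: real))"
  using assms by (induction A rule: finite_induct) auto

text \<open>The reflection \<open>c \<mapsto> m - c\<close> of the modes negates the energy.\<close>

lemma sum_weight_top:
  assumes "n < m" and parity: "even k \<longleftrightarrow> even ((\<Sum>i<n. x i) + (\<Sum>i<n. y i))"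
  shows "(\<Sum>K\<in>top_choices n m. energy n m K ^ k * weight n m K x y)
    = (\<Sum>K\<in>ground n m. energy n m K ^ k * weight n m K x y)"
proof -
  define refl :: "(nat \<Rightarrow> nat) \<Rightarrow> nat \<Rightarrow> nat" where "refl K = (\<lambda>i\<in>{..<n}. m - K i)" for K
  have range: "1 \<le> K i" "K i < m" if "K \<in> mode_choices n m" "i < n" for K i
    using that by (auto simp: mode_choices_def PiE_iff)
  have refl_mem: "refl K \<in> mode_choices n m" if "K \<in> mode_choices n m" for K
  proof -
    have "m - K i \<in> {1..<m}" if "i < n" for i using range[OF \<open>K \<in> _\<close> that] by simp
    then show ?thesis by (simp add: mode_choices_def refl_def)
  qed
  have refl_refl: "refl (refl K) = K" if "K \<in> mode_choices n m" for K
  proof -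
    have ext: "K \<in> extensional {..<n}" using that by (simp add: mode_choices_def PiE_def)
    show ?thesis
    proof
      fix i
      show "refl (refl K) i = K i"
        using range(2)[OF that, of i] extensional_arb[OF ext, of i] by (cases "i < n") (simp_all add: refl_def)
    qed
  qed
  have refl_inj: "inj_on (refl K) {..<n}" if "inj_on K {..<n}" "K \<in> mode_choices n m" for K
  proof (rule inj_onI)
    fix i j assume ij: "i \<in> {..<n}" "j \<in> {..<n}" "refl K i = refl K j"
    then have "m - K i = m - K j" "K i < m" "K j < m"
      using range(2)[OF that(2)] by (auto simp: refl_def)
    then have "K i = K j" by linarith
    then show "i = j" using that(1) ij by (auto simp: inj_on_def)
  qed
  have refl_image: "refl K ` {..<n} = (\<lambda>c. m - c) ` K ` {..<n}" for K
    by (auto simp: refl_def)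
  have img: "(\<lambda>c. m - c) ` {1..n} = {m - n..<m}" "(\<lambda>c. m - c) ` {m - n..<m} = {1..n}"
    using image_reflect_initial[OF \<open>n < m\<close>] image_reflect_reflect[of "{1..n}" m] \<open>n < m\<close> by auto
  have reflected: "energy n m (refl K) ^ k * weight n m (refl K) x y = energy n m K ^ k * weight n m K x y"
    if K: "K \<in> mode_choices n m" for K
  proof -
    let ?s = "\<lambda>z::int. if even z then - 1 else (1::real)"
    have m: "m > 0" using \<open>n < m\<close> by simp
    have mode: "mode m (refl K i) z = ?s z * mode m (K i) z" if "i < n" for i z
      using range[OF K that] that m by (simp add: refl_def mode_reflect)
    have "cos (pi * real (refl K i) / real m) = - cos (pi * real (K i) / real m)" if "i < n" for i
    proof -
      have "pi * real (refl K i) / real m = pi - pi * real (K i) / real m"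
        using range[OF K that] that m by (simp add: refl_def of_nat_diff field_simps)
      then show ?thesis by (simp add: cos_diff)
    qed
    then have e: "energy n m (refl K) = - energy n m K"
      by (simp add: energy_def sum_negf[symmetric])
    have "slater n m (refl K) y = det (mat n n (\<lambda>(i, j). ?s (y j) * mode m (K i) (y j)))"
      unfolding slater_def by (intro arg_cong[of _ _ det] eq_matI) (auto simp: mode)
    also have "\<dots> = (\<Prod>i<n. ?s (y i)) * slater n m K y"
      unfolding det_cols_mul slater_def ..
    finally have "weight n m (refl K) x y = ((\<Prod>i<n. ?s (x i)) * (\<Prod>i<n. ?s (y i))) * weight n m K x y"
      by (simp add: weight_def mode prod.distrib)
    \<comment> \<open>The two factors (-1)^n cancel and leave the sign of the total coordinate sum.
      By the parity hypothesis it is (-1)^k, which compensates for the negated energy.\<close>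
    also have "(\<Prod>i<n. ?s (x i)) * (\<Prod>i<n. ?s (y i)) = (- 1) ^ k"
      using parity by (auto simp: prod_parity_sign)
    finally show ?thesis
      by (simp add: e power_minus[of "energy n m K"])
  qed
  show ?thesis
    by (rule sum.reindex_bij_witness[of _ refl refl])
      (auto simp: ground_def top_choices_def refl_mem refl_refl refl_inj refl_image img reflected
        simp del: One_nat_def)
qed

text \<open>The upper bound compares the mode set with 1, ..., n. The lower bound is the same
  comparison for the reflected set, since the cosine at m - c is the negative of that at c.\<close>

lemma abs_energy_less:
  assumes "n < m" and K: "K \<in> mode_choices n m" "inj_on K {..<n}"
    and not_extremal: "K \<notin> ground n m" "K \<notin> top_choices n m"
  shows "\<bar>energy n m K\<bar> < energy n m Suc"
proof -
  define S where "S = K ` {..<n}"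
  define f where "f c = cos (pi * real c / real m)" for c
  have m: "m > 0" using assms by simp
  have dec: "f b < f a" if "a < b" "b < m" for a b
    unfolding f_def using that m
    by (intro cos_monotone_0_pi) (auto simp: field_simps)
  have S: "S \<subseteq> {1..<m}" "card S = n" "S \<noteq> {1..n}" "S \<noteq> {m - n..<m}"
    using assms by (auto simp: S_def mode_choices_def card_image ground_def top_choices_def)
  have upper: "sum f S < sum f {1..n}"
    using \<open>n < m\<close> S by (intro sum_less_sum_initial[of n m f]) (auto intro: dec)
  let ?S' = "(\<lambda>c. m - c) ` S"
  have "c = m - (m - c)" if "c \<in> S" for c using S(1) that by auto
  then have inj: "inj_on (\<lambda>c. m - c) S" by (rule inj_on_inverseI[OF sym])
  have "?S' \<noteq> {1..n}"
  proof
    assume "?S' = {1..n}"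
    moreover have "(\<lambda>c. m - c) ` ?S' = S"
      using S(1) by (intro image_reflect_reflect) auto
    ultimately show False using S(4) image_reflect_initial[OF \<open>n < m\<close>] by simp
  qed
  moreover have "?S' \<subseteq> {1..<m}" using S(1) by fastforce
  ultimately have "sum f ?S' < sum f {1..n}"
    using \<open>n < m\<close> S inj by (intro sum_less_sum_initial[of n m f]) (auto intro: dec simp: card_image)
  moreover have "sum f ?S' = - sum f S"
  proof -
    have "f (m - c) = - f c" if "c \<in> S" for c
    proof -
      have "pi * real (m - c) / real m = pi - pi * real c / real m"
        using S(1) that m by (auto simp: of_nat_diff field_simps)
      then show ?thesis by (simp add: f_def cos_diff)
    qed
    then show ?thesis by (simp add: sum.reindex[OF inj] sum_negf)
  qed
  ultimately have "\<bar>sum f S\<bar> < sum f {1..n}" using upper by linarith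
  moreover have "energy n m K = 2 * sum f S" using K by (simp add: energy_inj S_def f_def)
  moreover have "energy n m Suc = 2 * sum f {1..n}" by (simp add: energy_inj Suc_image_lessThan f_def)
  ultimately show ?thesis by simp
qed

section \<open>The leading energy, the leading coefficient and the limit\<close>

lemma energy_Suc:
  assumes "m > 0"
  shows "energy n m Suc = 2 * sin (real n * pi / (2 * real m)) * cos ((real n + 1) * pi / (2 * real m))
            / sin (pi / (2 * real m))"
proof -
  have "sin (pi / real m / 2) > 0" using assms by (intro sin_gt_zero) (auto simp: field_simps)
  from sum_cos_multiples[OF this, of n] show ?thesis
    by (simp add: energy_def sum_distrib_left[symmetric] ac_simps)
qed

text \<open>The condition m > n + 1 keeps the argument of the cosine below pi/2; at m = n + 1 it
  equals pi/2 and the energy is 0.\<close>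

lemma energy_Suc_pos:
  assumes "n > 0" "n + 1 < m"
  shows "energy n m Suc > 0"
proof -
  have "sin (real n * pi / (2 * real m)) > 0" "sin (pi / (2 * real m)) > 0"
    using assms by (auto intro!: sin_gt_zero simp: field_simps)
  moreover have "cos ((real n + 1) * pi / (2 * real m)) > 0"
  proof (intro cos_gt_zero)
    show "(real n + 1) * pi / (2 * real m) < pi / 2"
      using assms mult_strict_left_mono[of "real n + 1" "real m" pi]
      by (simp add: field_simps)
  qed (use assms in simp)
  ultimately show ?thesis using assms by (simp add: energy_Suc)
qed

text \<open>Inside the alcove all differences and sums in the product formula lie strictly between 0
  and 2m, so every sine is positive. This permits division by the leading coefficient.\<close>

lemma slater_Suc_nonzero:
  assumes x: "in_alcove n m x"
  shows "slater n m Suc x \<noteq> 0"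
proof -
  have ne: "sin (pi * real_of_int d / (2 * real m)) \<noteq> 0" if "0 < d" "d < 2 * int m" for d
  proof -
    have "real_of_int d < real_of_int (2 * int m)" using that by linarith
    then have "0 < sin (pi * real_of_int d / (2 * real m))"
      using that by (intro sin_gt_zero) (auto simp: field_simps)
    then show ?thesis by simp
  qed
  have bounds: "0 < x i" "x i < int m" if "i < n" for i
    using in_alcove_bounds[OF x that] by auto
  have "sin (pi * real_of_int (x h - x t) / (2 * real m)) \<noteq> 0" if "t < n" "h < t" for h t
    using bounds[of t] bounds[of h] in_alcove_strict_antimono[OF x that(2,1)] that by (intro ne) auto
  moreover have "sin (pi * real_of_int (x h + x t) / (2 * real m)) \<noteq> 0" if "t < n" "h \<le> t" for h t
    using bounds[of t] bounds[of h] that by (intro ne) auto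
  ultimately show ?thesis by (simp add: slater_Suc del: of_int_add of_int_diff)
qed

text \<open>The factor 2 arises because on the given parity class the top choices contribute as much
  as the ground ones.\<close>

lemma spectral_sum_extremal:
  assumes "n > 0" "n + 1 < m" and parity: "even k \<longleftrightarrow> even ((\<Sum>i<n. x i) + (\<Sum>i<n. y i))"
  shows "spectral_sum n m k x y = (2 / real m) ^ n
    * (2 * energy n m Suc ^ k * slater n m Suc x * slater n m Suc y
       + (\<Sum>K\<in>mode_choices n m - ground n m - top_choices n m. energy n m K ^ k * weight n m K x y))"
proof -
  have sub: "ground n m \<subseteq> mode_choices n m" "top_choices n m \<subseteq> mode_choices n m"
    by (auto simp: ground_def top_choices_def)
  \<comment> \<open>The mode 1 separates the two sets, because m - n > 1.\<close>
  have "{1..n} \<noteq> {m - n..<m}"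
  proof
    assume "{1..n} = {m - n..<m}"
    moreover have "1 \<in> {1..n}" using assms by simp
    ultimately show False using assms by auto
  qed
  then have disj: "top_choices n m \<subseteq> mode_choices n m - ground n m"
    by (auto simp: ground_def top_choices_def)
  have "(\<Sum>K\<in>ground n m. energy n m K ^ k * weight n m K x y)
      = energy n m Suc ^ k * (slater n m Suc x * slater n m Suc y)"
    using assms by (simp add: energy_ground sum_weight_ground sum_distrib_left[symmetric])
  moreover have "(\<Sum>K\<in>top_choices n m. energy n m K ^ k * weight n m K x y)
      = (\<Sum>K\<in>ground n m. energy n m K ^ k * weight n m K x y)"
    using assms by (intro sum_weight_top) auto
  moreover have "(\<Sum>K\<in>mode_choices n m. energy n m K ^ k * weight n m K x y)
      = (\<Sum>K\<in>mode_choices n m - ground n m - top_choices n m. energy n m K ^ k * weight n m K x y)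
        + (\<Sum>K\<in>top_choices n m. energy n m K ^ k * weight n m K x y)
        + (\<Sum>K\<in>ground n m. energy n m K ^ k * weight n m K x y)"
    using sub(1) disj by (simp add: sum.subset_diff)
  ultimately show ?thesis by (simp add: spectral_sum_def)
qed

lemma energy_Suc_zero:
  assumes "m = n + 1"
  shows "energy n m Suc = 0"
proof -
  have "(real n + 1) * pi / (2 * real m) = pi / 2"
    using assms by (simp add: field_simps)
  then have "cos ((real n + 1) * pi / (2 * real m)) = 0" by (simp only: cos_pi_half)
  then show ?thesis using assms energy_Suc[of m n] by simp
qed

text \<open>If \<open>m = n + 1\<close>, every injective choice of modes is extremal and has energy \<open>0\<close>.\<close>

lemma spectral_sum_single_point:
  assumes "m = n + 1" "k > 0"
  shows "spectral_sum n m k x y = 0"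
proof -
  have "energy n m K ^ k * weight n m K x y = 0" if K: "K \<in> mode_choices n m" for K
  proof (cases "inj_on K {..<n}")
    case True
    have "K ` {..<n} \<subseteq> {1..<m}" using K by (auto simp: mode_choices_def PiE_iff)
    also have "{1..<m} = {1..n}" using assms(1) by auto
    finally have "K ` {..<n} \<subseteq> {1..n}" .
    moreover have "card (K ` {..<n}) = card {1..n}" using True by (simp add: card_image)
    ultimately have "K ` {..<n} = {1..n}" by (intro card_subset_eq finite_atLeastAtMost)
    then have "energy n m K = energy n m Suc"
      using True K by (intro energy_ground) (simp add: ground_def)
    also have "\<dots> = 0" using assms(1) by (rule energy_Suc_zero)
    finally show ?thesis using assms(2) by simp
  qed (simp add: weight_def slater_not_inj)
  then have "(\<Sum>K\<in>mode_choices n m. energy n m K ^ k * weight n m K x y) = 0"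
    by (intro sum.neutral ballI)
  then show ?thesis by (simp add: spectral_sum_def)
qed

text \<open>Division by the leading term leaves 1 plus finitely many geometric sequences. Their
  ratios have modulus below 1, except possibly for non-injective choices, whose coefficients
  vanish.\<close>

lemma spectral_sum_tendsto:
  assumes n: "n > 0" and m: "n + 1 < m"
    and x: "in_alcove n m x" and y: "in_alcove n m y"
  defines "a \<equiv> 2 * (2 / real m) ^ n * slater n m Suc x * slater n m Suc y"
  shows "((\<lambda>k. spectral_sum n m k x y / (a * energy n m Suc ^ k)) \<longlongrightarrow> 1)
    (inf at_top (principal {k. even k \<longleftrightarrow> even ((\<Sum>i<n. x i) + (\<Sum>i<n. y i))}))"
proof -
  let ?rest = "mode_choices n m - ground n m - top_choices n m"
  let ?E = "energy n m Suc"
  let ?F = "inf at_top (principal {k. even k \<longleftrightarrow> even ((\<Sum>i<n. x i) + (\<Sum>i<n. y i))})"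
  define b where "b K = (2 / real m) ^ n * weight n m K x y / a" for K
  have E: "?E > 0" using n m by (rule energy_Suc_pos)
  have a: "a \<noteq> 0"
    using m slater_Suc_nonzero[OF x] slater_Suc_nonzero[OF y] by (simp add: a_def)
  have "(\<lambda>k. b K * (energy n m K / ?E) ^ k) \<longlonglongrightarrow> 0" if K: "K \<in> ?rest" for K
  proof (cases "inj_on K {..<n}")
    case True
    then have "\<bar>energy n m K\<bar> < ?E" using K m by (intro abs_energy_less) auto
    then have "norm (energy n m K / ?E) < 1" using E by simp
    from tendsto_mult_right_zero[OF LIMSEQ_power_zero[OF this]] show ?thesis .
  next
    case False
    then show ?thesis by (simp add: b_def weight_def slater_not_inj)
  qed
  then have "(\<lambda>k. 1 + (\<Sum>K\<in>?rest. b K * (energy n m K / ?E) ^ k)) \<longlonglongrightarrow> 1 + (\<Sum>K\<in>?rest. 0)"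
    by (intro tendsto_add tendsto_const tendsto_sum)
  \<comment> \<open>This convergence holds along all k; parity enters only when the expression is
    identified with the spectral sum.\<close>
  then have lim: "((\<lambda>k. 1 + (\<Sum>K\<in>?rest. b K * (energy n m K / ?E) ^ k)) \<longlongrightarrow> 1) ?F"
    by (auto intro: tendsto_mono[OF inf_le1])
  have "1 + (\<Sum>K\<in>?rest. b K * (energy n m K / ?E) ^ k) = spectral_sum n m k x y / (a * ?E ^ k)"
    if "even k \<longleftrightarrow> even ((\<Sum>i<n. x i) + (\<Sum>i<n. y i))" for k
  proof -
    let ?R = "\<Sum>K\<in>?rest. energy n m K ^ k * weight n m K x y"
    have "(\<Sum>K\<in>?rest. b K * (energy n m K / ?E) ^ k) = (2 / real m) ^ n * ?R / (a * ?E ^ k)"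
      unfolding sum_distrib_left sum_divide_distrib
      by (intro sum.cong refl) (simp add: b_def power_divide ac_simps)
    moreover have "spectral_sum n m k x y = a * ?E ^ k + (2 / real m) ^ n * ?R"
      unfolding spectral_sum_extremal[OF n m that] a_def by (simp add: algebra_simps)
    ultimately show ?thesis using a E by (simp add: add_divide_distrib)
  qed
  then have "eventually (\<lambda>k. 1 + (\<Sum>K\<in>?rest. b K * (energy n m K / ?E) ^ k)
      = spectral_sum n m k x y / (a * ?E ^ k)) ?F"
    by (simp add: eventually_inf_principal)
  with lim show ?thesis by (rule Lim_transform_eventually)
qed

theorem theorem21:
  fixes n m :: nat and \<eta> \<mu> :: "int vec"
  assumes "n \<ge> 1" and "m > 0"
    and "map_vec real_of_int \<eta> \<in> alcove n m"
    and "map_vec real_of_int \<mu> \<in> alcove n m"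
  shows "(\<lambda>k. real (card (walks n (alcove n m) k (map_vec real_of_int \<eta>) (map_vec real_of_int \<mu>))))
    \<sim>[inf at_top (principal {k. [int k = coord_sum \<eta> + coord_sum \<mu>] (mod 2)})]
    (\<lambda>k. 2 ^ (2 * n\<^sup>2 - n + 1) / real m ^ n
       * (2 * sin (real n * pi / (2 * real m)) * cos ((real n + 1) * pi / (2 * real m))
            / sin (pi / (2 * real m))) ^ k
       * (\<Prod>t<n. \<Prod>h<t. sin (pi * real_of_int (\<eta> $ h - \<eta> $ t) / (2 * real m))
                         * sin (pi * real_of_int (\<mu> $ h - \<mu> $ t) / (2 * real m)))
       * (\<Prod>t<n. \<Prod>h\<le>t. sin (pi * real_of_int (\<eta> $ h + \<eta> $ t) / (2 * real m))
                         * sin (pi * real_of_int (\<mu> $ h + \<mu> $ t) / (2 * real m))))"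
    (is "_ \<sim>[?F] ?rhs")
proof -
  have n: "n > 0" using assms(1) by simp
  define x where "x i = \<eta> $ i" for i
  define y where "y i = \<mu> $ i" for i
  have dim: "dim_vec \<eta> = n" "dim_vec \<mu> = n" using assms(3,4) by (auto simp: alcove_def)
  have emb: "map_vec real_of_int \<eta> = embed n x" "map_vec real_of_int \<mu> = embed n y"
    using dim by (auto simp: embed_def x_def y_def)
  have x: "in_alcove n m x" and y: "in_alcove n m y"
    using assms(3,4) n by (simp_all add: emb embed_in_alcove)
  have lhs: "(\<lambda>k. real (card (walks n (alcove n m) k (map_vec real_of_int \<eta>) (map_vec real_of_int \<mu>))))
      = (\<lambda>k. spectral_sum n m k x y)"
    using card_walks_eq_spectral_sum[OF n y x] by (simp add: emb)
  have parity: "{k. [int k = coord_sum \<eta> + coord_sum \<mu>] (mod 2)}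
      = {k. even k \<longleftrightarrow> even ((\<Sum>i<n. x i) + (\<Sum>i<n. y i))}"
    by (auto simp: coord_sum_def dim x_def y_def cong_iff_dvd_diff)
  define a where "a = 2 * (2 / real m) ^ n * slater n m Suc x * slater n m Suc y"
  have rhs: "?rhs = (\<lambda>k. a * energy n m Suc ^ k)"
  proof
    fix k
    \<comment> \<open>The exponent collects 1 from the two extremal classes, n from the
      normalisation and n(n - 1) from each of the two determinants.\<close>
    have "2 * n\<^sup>2 - n + 1 = 1 + n + n * (n - 1) + n * (n - 1)"
      using n by (cases n) (auto simp: power2_eq_square algebra_simps)
    then have "(2::real) ^ (2 * n\<^sup>2 - n + 1) = 2 * 2 ^ n * 2 ^ (n * (n - 1)) * 2 ^ (n * (n - 1))"
      by (simp only: power_add power_one_right)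
    then show "?rhs k = a * energy n m Suc ^ k"
      using assms(2) by (simp add: a_def slater_Suc energy_Suc prod.distrib power_divide x_def y_def)
  qed
  consider "m = n + 1" | "n + 1 < m" using in_alcove_imp_less[OF n x] by linarith
  then show ?thesis
  proof cases
    case 1
    \<comment> \<open>Both sides vanish for k > 0. The value k = 0, where the power of the zero
      energy is 1, is discarded by passing to eventual equality.\<close>
    have "eventually (\<lambda>k. spectral_sum n m k x y = a * energy n m Suc ^ k) ?F"
      unfolding eventually_inf_principal
      using eventually_gt_at_top[of "0::nat"]
    proof eventually_elim
      case (elim k)
      then show ?case using 1 by (simp add: spectral_sum_single_point energy_Suc_zero)
    qed
    then show ?thesis unfolding lhs rhs
      by (rule asymp_equiv_refl_ev)
  next
    case 2
    show ?thesis
      unfolding lhs rhs parity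
      using spectral_sum_tendsto[OF n 2 x y] by (intro asymp_equivI') (simp add: a_def)
  qed
qed

end
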